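(* Let $(\mu_\varepsilon)_{0\le\varepsilon\le1}$ be a family of probability distributions on $\mathbb{R}$ with cumulant generating functions $K_\varepsilon$, and let $x\in\mathbb{R}$ satisfy $\int_{\mathbb{R}}y\,\mu_0(dy)\neq x$. Assume: (A1) for each $\varepsilon\in[0,1]$, the effective domain $\mathcal{D}_\varepsilon$ of $K_\varepsilon$ contains an open interval that includes $0$; (A2) for each $\varepsilon\in[0,1]$, the support of $\mu_\varepsilon$ is equal to $\mathbb{R}$, and the characteristic function of $\mu_\varepsilon$ is integrable, i.e. $\int_{-\infty}^\infty\left|\int_{-\infty}^\infty e^{i\xi y}\mu_\varepsilon(dy)\right|d\xi<\infty$; (A3) there is $\delta_0>0$ such that $K''_\varepsilon(\theta)\ge\delta_0$ for each $\theta\in\mathcal{O}_\varepsilon$ and $\varepsilon\in[0,1]$; (A4) for each $\varepsilon$ there is an interval $\mathcal{I}_\varepsilon\subset\mathcal{D}_\varepsilon$ such that $\mathcal{I}_\varepsilon\nearrow\mathbb{R}$ as $\varepsilon\to0$; that is, $\mathcal{I}_\varepsilon\subset\mathcal{I}_{\varepsilon'}$ for each $\varepsilon\ge\varepsilon'$, and $\bigcup_\varepsilon\mathcal{I}_\varepsilon=\mathbb{R}$; (A5) for each nonnegative integer $r$, $K^{(r)}_\varepsilon$ converges to $K^{(r)}_0$ uniformly on any compact subset of $\mathbb{R}$ as $\varepsilon\to0$; moreover, for each integer $r\ge3$ and each compact $C\subset\mathbb{R}$, $\limsup_{\varepsilon\to0}\sup_{\theta\in C}\varepsilon^{-(r-2)}|K^{(r)}_\varepsilon(\theta)|<\infty$;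 (A6) there exists $\varepsilon_0\in(0,1]$ such that $\sum_{k=2}^\infty\frac{C_k}{k!}\varepsilon_0^k<\infty$, where $C_n$ ($n\ge2$) are the positive constants, described in the context, in the bounds $|\hat\theta^{(n)}_\varepsilon|\le C_n\varepsilon^{n-1}$; (A7) there exists $\varepsilon_1\in(0,1]$ such that $\sum_{m=1}^\infty\frac{C'_{2m+1}}{(2m)!!}\varepsilon_1^{2m+1}<\infty$, where $C'_n$ ($n\ge2$) are the positive constants, described in the context, in the bounds $|h_\varepsilon^{(n)}(\hat w_\varepsilon)|\le C'_n\varepsilon^n$. Assume also that the exact Lugannani–Rice expansion $$\mu_\varepsilon((x,\infty))=1-\Phi(\hat w_\varepsilon)+\sum_{m=0}^\infty\Psi^\varepsilon_m(\hat w_\varepsilon)$$ holds. Then, for each $M\ge0$, $$\mu_\varepsilon((x,\infty))=1-\Phi(\hat w_\varepsilon)+\sum_{m=0}^M\Psi^\varepsilon_m(\hat w_\varepsilon)+O(\varepsilon^{2M+3})\qquad\text{as }\varepsilon\to0.$$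
   Context: $K_\varepsilon(\theta)=\log\int_{\mathbb{R}}e^{\theta y}\mu_\varepsilon(dy)$; $\mathcal{D}_\varepsilon=\{\theta\in\mathbb{R}:|K_\varepsilon(\theta)|<\infty\}$; $\mathcal{O}_\varepsilon$ is the interior of $\mathcal{D}_\varepsilon$. The saddlepoint $\hat\theta_\varepsilon\in\mathcal{O}_\varepsilon$ is the solution of $K'_\varepsilon(\hat\theta_\varepsilon)=x$; the source states that under (A1)–(A2) $K_\varepsilon$ is strictly convex and the range of $K'_\varepsilon$ is $\mathbb{R}$, so that this solution always exists. (By (A4), every compact set lies in $\mathcal{D}_\varepsilon$ for small $\varepsilon$, so (A5) makes sense for small $\varepsilon$; under the assumptions $\hat\theta_\varepsilon\ne0$ for small $\varepsilon$.) Set $\mathrm{sgn}(a)=1$ for $a\ge0$, $-1$ for $a<0$, and $\hat w_\varepsilon=\mathrm{sgn}(\hat\theta_\varepsilon)\sqrt{2(x\hat\theta_\varepsilon-K_\varepsilon(\hat\theta_\varepsilon))}$. Put $$w_\varepsilon(\theta)=\hat w_\varepsilon+\mathrm{sgn}(\theta-\hat\theta_\varepsilon)\sqrt{2\{(K_\varepsilon(\theta)-x\theta)-(K_\varepsilon(\hat\theta_\varepsilon)-x\hat\theta_\varepsilon)\}},$$ which is real analytic on $\mathcal{O}_\varepsilon$ with nonvanishing derivative; let $\theta_\varepsilon(w)$ be its analytic inverse function, and $\hat\theta^{(n)}_\varepsilon=\frac{d^n\theta_\varepsilon}{dw^n}(\hat w_\varepsilon)$. Near $\hat w_\varepsilon$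 define $h_\varepsilon(w)=\log(\theta_\varepsilon(w)/w)$, $\psi_\varepsilon(w)=h_\varepsilon'(w)=\frac{\theta_\varepsilon'(w)}{\theta_\varepsilon(w)}-\frac1w$, and $$\Psi^\varepsilon_m(w)=\phi(w)\frac{(-1)^m}{(2m)!!}\psi_\varepsilon^{(2m)}(w),$$ with $(2m)!!=(2m)(2m-2)\cdots4\cdot2$, $0!!=1$; $\Phi$ is the standard normal distribution function and $\phi=\Phi'$. Constants $C_n$: under (A1)–(A5) one has, for each $n\ge2$, $\hat\theta^{(n)}_\varepsilon=O(\varepsilon^{n-1})$ as $\varepsilon\to0$; accordingly there are positive constants $C_n$ ($n\ge2$) such that $|\hat\theta^{(n)}_\varepsilon|\le C_n\varepsilon^{n-1}$. These are the constants in (A6). Constants $C'_n$: under (A1)–(A6) one has, for each $n\ge1$, $h_\varepsilon^{(n)}(\hat w_\varepsilon)=O(\varepsilon^n)$ as $\varepsilon\to0$; accordingly there are positive constants $C'_n$ ($n\ge2$) such that $|h_\varepsilon^{(n)}(\hat w_\varepsilon)|\le C'_n\varepsilon^n$, and hence $|\Psi^\varepsilon_m(\hat w_\varepsilon)|\le\phi(\hat w_\varepsilon)\frac{C'_{2m+1}}{(2m)!!}\varepsilon^{2m+1}$. These are the constants in (A7). $a_\varepsilon=O(\varepsilon^r)$ as $\varepsilon\to0$ means $\limsup_{\varepsilon\to0}\varepsilon^{-r}|a_\varepsilon|<\infty$. *)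

theory Defs
  imports "HOL-Probability.Probability" "HOL-Library.Landau_Symbols"
begin

(* exp (\<theta> * y) is positive, so the log of its integral is finite exactly
   when the integral is; outside this set the Bochner integral is 0 and cgf has
   no meaning. *)
definition cgf_domain :: "real measure \<Rightarrow> real set" where
  "cgf_domain M = {\<theta>. integrable M (\<lambda>y. exp (\<theta> * y))}"

definition cgf :: "real measure \<Rightarrow> real \<Rightarrow> real" where
  "cgf M \<theta> = ln (\<integral>y. exp (\<theta> * y) \<partial>M)"

definition measure_support :: "real measure \<Rightarrow> real set" where
  "measure_support M = {y. \<forall>U. open U \<and> y \<in> U \<longrightarrow> emeasure M U > 0}"

(* Differs from the library's sgn at 0. *)
definition sgn1 :: "real \<Rightarrow> real" where
  "sgn1 a = (if a \<ge> 0 then 1 else - 1)"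

fun double_fact :: "nat \<Rightarrow> nat" where
  "double_fact 0 = 1"
| "double_fact (Suc 0) = 1"
| "double_fact (Suc (Suc n)) = Suc (Suc n) * double_fact n"

definition saddlepoint :: "real measure \<Rightarrow> real \<Rightarrow> real" where
  "saddlepoint M x =
     (THE \<theta>. \<theta> \<in> interior (cgf_domain M) \<and> deriv (cgf M) \<theta> = x)"

definition w_hat :: "real measure \<Rightarrow> real \<Rightarrow> real" where
  "w_hat M x = sgn1 (saddlepoint M x) *
     sqrt (2 * (x * saddlepoint M x - cgf M (saddlepoint M x)))"

definition w_fun :: "real measure \<Rightarrow> real \<Rightarrow> real \<Rightarrow> real" where
  "w_fun M x \<theta> = w_hat M x + sgn1 (\<theta> - saddlepoint M x) *
     sqrt (2 * ((cgf M \<theta> - x * \<theta>)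
                - (cgf M (saddlepoint M x) - x * saddlepoint M x)))"

(* Meaningful on the open set w_fun M x ` interior (cgf_domain M), which contains
   w_hat M x; only derivatives at w_hat M x are used below. *)
definition theta_fun :: "real measure \<Rightarrow> real \<Rightarrow> real \<Rightarrow> real" where
  "theta_fun M x = the_inv_into (interior (cgf_domain M)) (w_fun M x)"

definition h_fun :: "real measure \<Rightarrow> real \<Rightarrow> real \<Rightarrow> real" where
  "h_fun M x w = ln (theta_fun M x w / w)"

definition psi_fun :: "real measure \<Rightarrow> real \<Rightarrow> real \<Rightarrow> real" where
  "psi_fun M x = deriv (h_fun M x)"

definition Psi :: "real measure \<Rightarrow> real \<Rightarrow> nat \<Rightarrow> real \<Rightarrow> real" where
  "Psi M x m w = std_normal_density w * ((- 1) ^ m / real (double_fact (2 * m)))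
     * (deriv ^^ (2 * m)) (psi_fun M x) w"

definition std_normal_cdf :: "real \<Rightarrow> real" where
  "std_normal_cdf = cdf std_normal_distribution"

end

theory Submission
  imports Defs
begin

text \<open>The remainder of the exact expansion is the tail \<open>m > M\<close> of a series whose terms are
dominated by \<open>C'\<^sub>2\<^sub>m\<^sub>+\<^sub>1 \<epsilon>\<^sup>2\<^sup>m\<^sup>+\<^sup>1 / (2m)!!\<close>, and for \<open>\<epsilon> \<le> \<epsilon>\<^sub>1\<close> each of these loses at least a factor
\<open>(\<epsilon> / \<epsilon>\<^sub>1)\<^sup>2\<^sup>M\<^sup>+\<^sup>3\<close> against the corresponding term of the convergent series in (A7).\<close>

text \<open>Subtracting the first n terms leaves the series shifted by n, which is then compared
  termwise with \<open>g\<close>.\<close>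

lemma sums_remainder_bound:
  fixes f :: "nat \<Rightarrow> 'a::banach"
  assumes "f sums s" and "summable g" and "\<And>k. norm (f (k + n)) \<le> g k"
  shows "norm (s - sum f {..<n}) \<le> suminf g"
proof -
  have "(\<lambda>k. f (k + n)) sums (s - sum f {..<n})"
    using assms(1) by (simp add: sums_iff_shift)
  moreover have "norm (\<Sum>k. f (k + n)) \<le> suminf g"
    using assms(2,3) by (intro norm_suminf_le) auto
  ultimately show ?thesis
    by (simp add: sums_iff)
qed

lemma std_normal_density_le_1: "std_normal_density w \<le> 1"
proof -
  have "1 / sqrt (2 * pi) \<le> 1"
    using pi_gt3 by simp
  then have "1 / sqrt (2 * pi) * exp (- w\<^sup>2 / 2) \<le> 1 * 1"
    by (intro mult_mono) auto
  then show ?thesis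
    by (simp add: std_normal_density_def)
qed

text \<open>Since \<open>psi_fun\<close> is the derivative of \<open>h_fun\<close>, the order rises
  from 2m to 2m + 1. Bounding the density by 1 makes the estimate uniform in \<open>w\<close>, which
  matters because \<open>w_hat\<close> moves with \<epsilon>.\<close>

lemma abs_Psi_le:
  "\<bar>Psi M x m w\<bar> \<le> \<bar>(deriv ^^ (2 * m + 1)) (h_fun M x) w\<bar> / real (double_fact (2 * m))"
proof -
  have "(deriv ^^ (2 * m)) (psi_fun M x) w = (deriv ^^ (2 * m + 1)) (h_fun M x) w"
    \<comment> \<open>The extra \<open>deriv\<close> acts first, so the iterate must be unfolded at
      its innermost application.\<close>
    by (simp add: psi_fun_def funpow_Suc_right del: funpow.simps)
  then have "\<bar>Psi M x m w\<bar> = std_normal_density w *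
      (\<bar>(deriv ^^ (2 * m + 1)) (h_fun M x) w\<bar> / real (double_fact (2 * m)))"
    by (simp add: Psi_def abs_mult power_abs)
  also have "\<dots> \<le> 1 * (\<bar>(deriv ^^ (2 * m + 1)) (h_fun M x) w\<bar> / real (double_fact (2 * m)))"
    by (intro mult_right_mono std_normal_density_le_1) auto
  finally show ?thesis by simp
qed

text \<open>Write a^n = b^n (a/b)^n; as a/b lies in [0,1], lowering its exponent to m can only
  increase the right side. The factor (a/b)^m is then common to all n \<ge> m.\<close>

lemma power_le_scaled_power:
  fixes a b :: "'a::linordered_field"
  assumes "0 \<le> a" "a \<le> b" "0 < b" "m \<le> n"
  shows "a ^ n \<le> b ^ n * (a / b) ^ m"
proof -
  have "(a / b) ^ n \<le> (a / b) ^ m"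
    using assms by (intro power_decreasing) auto
  then have "b ^ n * (a / b) ^ n \<le> b ^ n * (a / b) ^ m"
    using assms by (intro mult_left_mono) auto
  then show ?thesis
    using assms by (simp add: power_divide)
qed

theorem theorem4:
  fixes \<mu> :: "real \<Rightarrow> real measure" and x :: real and C C' :: "nat \<Rightarrow> real"
  assumes distr: "\<And>\<epsilon>. \<epsilon> \<in> {0..1} \<Longrightarrow> real_distribution (\<mu> \<epsilon>)"
    and mean: "(\<integral>y. y \<partial>\<mu> 0) \<noteq> x"
    and A1: "\<And>\<epsilon>. \<epsilon> \<in> {0..1} \<Longrightarrow>
          \<exists>a b. a < 0 \<and> 0 < b \<and> {a<..<b} \<subseteq> cgf_domain (\<mu> \<epsilon>)"
    and A2_support: "\<And>\<epsilon>. \<epsilon> \<in> {0..1} \<Longrightarrow> measure_support (\<mu> \<epsilon>) = UNIV"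
    and A2_char: "\<And>\<epsilon>. \<epsilon> \<in> {0..1} \<Longrightarrow> integrable lborel (char (\<mu> \<epsilon>))"
    and A3: "\<exists>\<delta>0>0. \<forall>\<epsilon>\<in>{0..1}. \<forall>\<theta>\<in>interior (cgf_domain (\<mu> \<epsilon>)).
          (deriv ^^ 2) (cgf (\<mu> \<epsilon>)) \<theta> \<ge> \<delta>0"
    and A4: "\<exists>I :: real \<Rightarrow> real set.
          (\<forall>\<epsilon>\<in>{0..1}. is_interval (I \<epsilon>) \<and> I \<epsilon> \<subseteq> cgf_domain (\<mu> \<epsilon>)) \<and>
          (\<forall>\<epsilon>\<in>{0..1}. \<forall>\<epsilon>'\<in>{0..1}. \<epsilon> \<ge> \<epsilon>' \<longrightarrow> I \<epsilon> \<subseteq> I \<epsilon>') \<and>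
          (\<Union>\<epsilon>\<in>{0<..1}. I \<epsilon>) = UNIV"
    and A5_limit: "\<And>r S. compact S \<Longrightarrow>
          uniform_limit S (\<lambda>\<epsilon>. (deriv ^^ r) (cgf (\<mu> \<epsilon>))) ((deriv ^^ r) (cgf (\<mu> 0))) (at_right 0)"
    and A5_bound: "\<And>r S. r \<ge> 3 \<Longrightarrow> compact S \<Longrightarrow>
          Limsup (at_right (0::real))
            (\<lambda>\<epsilon>. SUP \<theta>\<in>S. ereal (\<bar>(deriv ^^ r) (cgf (\<mu> \<epsilon>)) \<theta>\<bar> / \<epsilon> ^ (r - 2))) < \<infinity>"
    and C_pos: "\<And>n. n \<ge> 2 \<Longrightarrow> C n > 0"
    and C_bound: "\<forall>\<^sub>F \<epsilon> in at_right 0. \<forall>n\<ge>2.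
          \<bar>(deriv ^^ n) (theta_fun (\<mu> \<epsilon>) x) (w_hat (\<mu> \<epsilon>) x)\<bar> \<le> C n * \<epsilon> ^ (n - 1)"
    and A6: "\<exists>\<epsilon>0\<in>{0<..1::real}. summable (\<lambda>k. C (k + 2) / fact (k + 2) * \<epsilon>0 ^ (k + 2))"
    and C'_pos: "\<And>n. n \<ge> 2 \<Longrightarrow> C' n > 0"
    and C'_bound: "\<forall>\<^sub>F \<epsilon> in at_right 0. \<forall>n\<ge>2.
          \<bar>(deriv ^^ n) (h_fun (\<mu> \<epsilon>) x) (w_hat (\<mu> \<epsilon>) x)\<bar> \<le> C' n * \<epsilon> ^ n"
    and A7: "\<exists>\<epsilon>1\<in>{0<..1::real}. summable (\<lambda>k.
          C' (2 * (k + 1) + 1) / real (double_fact (2 * (k + 1))) * \<epsilon>1 ^ (2 * (k + 1) + 1))"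
    and exact: "\<forall>\<^sub>F \<epsilon> in at_right 0.
          (\<lambda>m. Psi (\<mu> \<epsilon>) x m (w_hat (\<mu> \<epsilon>) x)) sums
            (measure (\<mu> \<epsilon>) {x<..} - (1 - std_normal_cdf (w_hat (\<mu> \<epsilon>) x)))"
  shows "\<forall>M. (\<lambda>\<epsilon>. measure (\<mu> \<epsilon>) {x<..}
            - (1 - std_normal_cdf (w_hat (\<mu> \<epsilon>) x)
               + (\<Sum>m\<le>M. Psi (\<mu> \<epsilon>) x m (w_hat (\<mu> \<epsilon>) x))))
          \<in> O[at_right 0](\<lambda>\<epsilon>. \<epsilon> ^ (2 * M + 3))"
proof
  fix M :: nat
  \<comment> \<open>The index \<open>k\<close> stands for m = k + 1, because the series in
    \<open>A7\<close> starts at m = 1.\<close>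
  define b where
    "b \<epsilon> k = C' (2 * (k + 1) + 1) / real (double_fact (2 * (k + 1))) * \<epsilon> ^ (2 * (k + 1) + 1)"
    for \<epsilon> k
  obtain \<epsilon>1 where \<epsilon>1: "0 < \<epsilon>1" "summable (b \<epsilon>1)"
    using A7 unfolding b_def by auto
  have summable_tail: "summable (\<lambda>k. b \<epsilon>1 (k + M))"
    using \<epsilon>1(2) by (simp add: summable_iff_shift)
  define R where "R \<epsilon> = measure (\<mu> \<epsilon>) {x<..} - (1 - std_normal_cdf (w_hat (\<mu> \<epsilon>) x)
      + (\<Sum>m\<le>M. Psi (\<mu> \<epsilon>) x m (w_hat (\<mu> \<epsilon>) x)))" for \<epsilon>
  have small: "\<forall>\<^sub>F \<epsilon> in at_right 0. \<epsilon> \<in> {0<..<\<epsilon>1}"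
    using \<epsilon>1(1) by (rule eventually_at_right_real)
  have "\<forall>\<^sub>F \<epsilon> in at_right 0.
      norm (R \<epsilon>) \<le> ((\<Sum>k. b \<epsilon>1 (k + M)) / \<epsilon>1 ^ (2 * M + 3)) * norm (\<epsilon> ^ (2 * M + 3))"
    using exact C'_bound small
  proof eventually_elim
    case (elim \<epsilon>)
    \<comment> \<open>The exponent 2M + 3 = 2(M + 1) + 1 belongs to the first omitted term, m = M +
      1.\<close>
    let ?w = "w_hat (\<mu> \<epsilon>) x" and ?q = "(\<epsilon> / \<epsilon>1) ^ (2 * M + 3)"
    have "norm (Psi (\<mu> \<epsilon>) x (k + Suc M) ?w) \<le> b \<epsilon>1 (k + M) * ?q" for k
    proof -
      let ?m = "k + M + 1"
      have "\<bar>Psi (\<mu> \<epsilon>) x ?m ?w\<bar>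
          \<le> \<bar>(deriv ^^ (2 * ?m + 1)) (h_fun (\<mu> \<epsilon>) x) ?w\<bar> / real (double_fact (2 * ?m))"
        by (rule abs_Psi_le)
      \<comment> \<open>\<open>C'_bound\<close> holds for all orders n at the same \<epsilon>, so it
        covers every term of the tail at once.\<close>
      also have "\<dots> \<le> C' (2 * ?m + 1) * \<epsilon> ^ (2 * ?m + 1) / real (double_fact (2 * ?m))"
        using elim(2)[rule_format, of "2 * ?m + 1"] by (intro divide_right_mono) auto
      also have "\<dots> = C' (2 * ?m + 1) / real (double_fact (2 * ?m)) * \<epsilon> ^ (2 * ?m + 1)"
        by simp
      \<comment> \<open>Here 2m + 1 \<ge> 2M + 3 and \<epsilon> < \<epsilon>1, so the gain
        \<open>?q\<close> can be split off independently of \<open>k\<close>.\<close>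
      also have "\<dots> \<le> C' (2 * ?m + 1) / real (double_fact (2 * ?m)) * (\<epsilon>1 ^ (2 * ?m + 1) * ?q)"
        using elim(3) C'_pos[of "2 * ?m + 1"]
        by (intro mult_left_mono power_le_scaled_power) (auto intro: divide_nonneg_nonneg)
      finally show ?thesis
        by (simp add: b_def mult.assoc)
    qed
    \<comment> \<open>The shift is \<open>Suc M\<close>, since the partial sum includes m =
      M.\<close>
    from sums_remainder_bound[OF elim(1) summable_mult2[OF summable_tail] this]
    have "norm (R \<epsilon>) \<le> (\<Sum>k. b \<epsilon>1 (k + M) * ?q)"
      by (simp add: R_def lessThan_Suc_atMost algebra_simps)
    also have "\<dots> = (\<Sum>k. b \<epsilon>1 (k + M)) * ?q"
      using suminf_mult2[OF summable_tail] by simp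
    finally show ?case
      using elim(3) by (simp add: power_divide)
  qed
  then show "R \<in> O[at_right 0](\<lambda>\<epsilon>. \<epsilon> ^ (2 * M + 3))" unfolding R_def
    by (rule bigoI)
qed

end
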